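(* Let $D=(V,A)$ be a digraph and let $\mathcal I$ be the family of all independent sets of arcs of $D$. Then $M(D)=(A,\mathcal I)$ is a graphic matroid, and its rank equals the maximum size of a set of arcs of $D$ containing no closed antidirected trail.
   Context: Digraphs are finite and loopless. For $F\subseteq A$ let $h(F)$ (resp. $t(F)$) be the number of vertices that are heads (resp. tails) of at least one arc of $F$. A set $I\subseteq A$ is independent if $|I'|\le h(I')+t(I')-1$ for all nonempty $I'\subseteq I$. In a walk (in the underlying graph) an arc $vw$ is forward if traversed from $v$ to $w$ and backward if traversed from $w$ to $v$. A closed antidirected trail is a closed walk of even length with no repeated arc whose arcs alternate between forward and backward arcs. *)

theory Defs
  imports "Graph_Theory.Digraph"
begin

section \<open>Independent sets of arcs\<close>

text \<open>
  The underlying structure is the arc-labelled digraph of the library, so parallel arcs are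
  allowed; simple digraphs are a special case.
\<close>

definition num_heads :: "('a, 'b) pre_digraph \<Rightarrow> 'b set \<Rightarrow> nat" where
  "num_heads D F = card (head D ` F)"

definition num_tails :: "('a, 'b) pre_digraph \<Rightarrow> 'b set \<Rightarrow> nat" where
  "num_tails D F = card (tail D ` F)"

definition independent_arcs :: "('a, 'b) pre_digraph \<Rightarrow> 'b set \<Rightarrow> bool" where
  "independent_arcs D I \<longleftrightarrow> I \<subseteq> arcs D \<and>
     (\<forall>I'. I' \<subseteq> I \<and> I' \<noteq> {} \<longrightarrow>
        int (card I') \<le> int (num_heads D I') + int (num_tails D I') - 1)"


section \<open>Closed antidirected trails\<close>

text \<open>
  A walk in the underlying graph is given by its vertices \<open>vs ! 0, ..., vs ! n\<close> and its arcs
  \<open>es ! 0, ..., es ! (n - 1)\<close>. In a loopless digraph no step is both forward and backward.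
\<close>

definition forward_step :: "('a, 'b) pre_digraph \<Rightarrow> 'a list \<Rightarrow> 'b list \<Rightarrow> nat \<Rightarrow> bool" where
  "forward_step D vs es i \<longleftrightarrow> tail D (es ! i) = vs ! i \<and> head D (es ! i) = vs ! Suc i"

definition backward_step :: "('a, 'b) pre_digraph \<Rightarrow> 'a list \<Rightarrow> 'b list \<Rightarrow> nat \<Rightarrow> bool" where
  "backward_step D vs es i \<longleftrightarrow> head D (es ! i) = vs ! i \<and> tail D (es ! i) = vs ! Suc i"

definition underlying_walk :: "('a, 'b) pre_digraph \<Rightarrow> 'a list \<Rightarrow> 'b list \<Rightarrow> bool" where
  "underlying_walk D vs es \<longleftrightarrow>
     length vs = Suc (length es) \<and> set vs \<subseteq> verts D \<and> set es \<subseteq> arcs D \<and>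
     (\<forall>i < length es. forward_step D vs es i \<or> backward_step D vs es i)"

text \<open>
  The trivial walk without arcs is not a closed trail: otherwise every set of arcs would
  contain one.
\<close>

definition closed_antidirected_trail ::
    "('a, 'b) pre_digraph \<Rightarrow> 'a list \<Rightarrow> 'b list \<Rightarrow> bool" where
  "closed_antidirected_trail D vs es \<longleftrightarrow>
     underlying_walk D vs es \<and> hd vs = last vs \<and>
     es \<noteq> [] \<and> even (length es) \<and> distinct es \<and>
     (\<forall>i. Suc i < length es \<longrightarrow>
        forward_step D vs es i \<and> backward_step D vs es (Suc i) \<or>
        backward_step D vs es i \<and> forward_step D vs es (Suc i))"

definition contains_closed_antidirected_trail ::
    "('a, 'b) pre_digraph \<Rightarrow> 'b set \<Rightarrow> bool" where
  "contains_closed_antidirected_trail D F \<longleftrightarrow>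
     (\<exists>vs es. closed_antidirected_trail D vs es \<and> set es \<subseteq> F)"


section \<open>Matroids\<close>

locale matroid =
  fixes E :: "'e set" and \<I> :: "'e set set"
  assumes finite_ground: "finite E"
    and indep_subset_ground: "I \<in> \<I> \<Longrightarrow> I \<subseteq> E"
    and indep_empty: "{} \<in> \<I>"
    and indep_subset: "I \<in> \<I> \<Longrightarrow> J \<subseteq> I \<Longrightarrow> J \<in> \<I>"
    and augmentation: "I \<in> \<I> \<Longrightarrow> J \<in> \<I> \<Longrightarrow> card I < card J \<Longrightarrow>
      \<exists>x \<in> J - I. insert x I \<in> \<I>"

definition matroid_rank :: "'e set set \<Rightarrow> nat" where
  "matroid_rank \<I> = Max (card ` \<I>)"

definition matroid_isomorphic ::
    "'e set \<Rightarrow> 'e set set \<Rightarrow> 'f set \<Rightarrow> 'f set set \<Rightarrow> bool" where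
  "matroid_isomorphic E \<I> F \<J> \<longleftrightarrow>
     (\<exists>f. bij_betw f E F \<and> (\<forall>X. X \<subseteq> E \<longrightarrow> (X \<in> \<I> \<longleftrightarrow> f ` X \<in> \<J>)))"


section \<open>Graphic matroids\<close>

text \<open>Undirected graphs, possibly with loops (one end) and parallel edges.\<close>

record ('v, 'e) multigraph =
  vertices :: "'v set"
  edges :: "'e set"
  ends :: "'e \<Rightarrow> 'v set"

definition finite_multigraph :: "('v, 'e) multigraph \<Rightarrow> bool" where
  "finite_multigraph G \<longleftrightarrow> finite (vertices G) \<and> finite (edges G) \<and>
     (\<forall>e \<in> edges G. ends G e \<subseteq> vertices G \<and> card (ends G e) \<in> {1, 2})"

text \<open>
  A cycle of length \<open>n \<ge> 1\<close>; loops are the cycles of length 1 and pairs of parallel edges those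
  of length 2.
\<close>

definition graph_cycle :: "('v, 'e) multigraph \<Rightarrow> 'v list \<Rightarrow> 'e list \<Rightarrow> bool" where
  "graph_cycle G vs es \<longleftrightarrow>
     es \<noteq> [] \<and> length vs = length es \<and> distinct vs \<and> distinct es \<and>
     set vs \<subseteq> vertices G \<and> set es \<subseteq> edges G \<and>
     (\<forall>i < length es. ends G (es ! i) = {vs ! i, vs ! (Suc i mod length es)})"

definition acyclic_edge_sets :: "('v, 'e) multigraph \<Rightarrow> 'e set set" where
  "acyclic_edge_sets G =
     {F. F \<subseteq> edges G \<and> \<not> (\<exists>vs es. graph_cycle G vs es \<and> set es \<subseteq> F)}"

text \<open>
  A matroid is graphic if it is isomorphic to the cycle matroid of a finite graph. Vertices and
  edges are natural numbers without loss of generality, as HOL cannot quantify over types.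
\<close>

definition graphic_matroid :: "'e set \<Rightarrow> 'e set set \<Rightarrow> bool" where
  "graphic_matroid E \<I> \<longleftrightarrow> matroid E \<I> \<and>
     (\<exists>G :: (nat, nat) multigraph. finite_multigraph G \<and>
        matroid_isomorphic E \<I> (edges G) (acyclic_edge_sets G))"

end

theory Submission
  imports Defs
begin

text \<open>
  Split every vertex of \<open>D\<close> into a tail copy and a head copy, so that the arcs become the edges of a
  bipartite graph. A set of arcs is independent iff every nonempty subset has fewer edges than
  covered vertices in that graph, i.e. iff it is a forest. Closed antidirected trails of \<open>D\<close> are
  the closed trails of the bipartite graph, so a set of arcs contains one iff it is not a forest.
  Thus the sets without a closed antidirected trail are exactly the independent sets.
\<close>

section \<open>Sparse families of finite sets\<close>

text \<open>For edges with their end sets this characterises forests, a loop failing already as a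
  singleton. Arbitrary sets \<open>inc e\<close> are allowed, which gives the hyperforests of
  Lorea's hypergraphic matroid.\<close>

definition sparse :: "('e \<Rightarrow> 'v set) \<Rightarrow> 'e set \<Rightarrow> bool" where
  "sparse inc F \<longleftrightarrow> (\<forall>X \<subseteq> F. X \<noteq> {} \<longrightarrow> card X < card (\<Union>(inc ` X)))"

lemma sparseD: "sparse inc F \<Longrightarrow> X \<subseteq> F \<Longrightarrow> X \<noteq> {} \<Longrightarrow> card X < card (\<Union>(inc ` X))"
  unfolding sparse_def by blast

lemma sparse_subset: "sparse inc F \<Longrightarrow> X \<subseteq> F \<Longrightarrow> sparse inc X"
  unfolding sparse_def by blast

lemma sparse_nonempty:
  assumes "sparse inc F" "e \<in> F"
  shows "inc e \<noteq> {}"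
  using sparseD[OF assms(1), of "{e}"] assms(2) by auto

text \<open>Injective relabelling of elements by \<open>f\<close> and of points by \<open>g\<close>
  changes neither cardinality that sparsity compares. It carries forests over to an isomorphic
  graph.\<close>

lemma sparse_image_iff:
  assumes f: "inj_on f E" and g: "inj_on g W"
    and inc: "\<And>e. e \<in> E \<Longrightarrow> inc e \<subseteq> W" and inc': "\<And>e. e \<in> E \<Longrightarrow> inc' (f e) = g ` inc e"
    and X: "X \<subseteq> E"
  shows "sparse inc' (f ` X) \<longleftrightarrow> sparse inc X"
proof -
  have card: "card (f ` Y) = card Y" "card (\<Union>(inc' ` f ` Y)) = card (\<Union>(inc ` Y))"
    if "Y \<subseteq> X" for Y
  proof -
    show "card (f ` Y) = card Y"
      using that X f by (meson card_image inj_on_subset subset_trans)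
    have "\<Union>(inc' ` f ` Y) = g ` \<Union>(inc ` Y)"
      using that X inc' by (auto simp: image_UN subset_iff)
    moreover have "\<Union>(inc ` Y) \<subseteq> W"
      using that X inc by blast
    ultimately show "card (\<Union>(inc' ` f ` Y)) = card (\<Union>(inc ` Y))"
      using g by (metis card_image inj_on_subset)
  qed
  have "sparse inc' (f ` X) \<longleftrightarrow>
      (\<forall>Y \<subseteq> X. f ` Y \<noteq> {} \<longrightarrow> card (f ` Y) < card (\<Union>(inc' ` f ` Y)))"
    unfolding sparse_def by (rule all_subset_image)
  also have "\<dots> \<longleftrightarrow> sparse inc X"
    unfolding sparse_def using card by auto
  finally show ?thesis .
qed

text \<open>
  Call a nonempty subfamily of \<open>I\<close> tight if it attains the bound of sparsity. By submodularity the
  maximal tight subfamilies have pairwise disjoint unions. An element of \<open>J\<close> that cannot be added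
  to \<open>I\<close> lies within the union of one of them, which contains at most as many elements of \<open>J\<close> as
  of \<open>I\<close>.
\<close>
lemma sparse_augmentation:
  assumes fin: "finite I" "finite J" and fin_inc: "\<And>e. e \<in> I \<union> J \<Longrightarrow> finite (inc e)"
    and I: "sparse inc I" and J: "sparse inc J" and less: "card I < card J"
  shows "\<exists>x \<in> J - I. sparse inc (insert x I)"
proof (rule ccontr)
  assume "\<not> ?thesis"
  hence no_ext: "\<not> sparse inc (insert x I)" if "x \<in> J - I" for x
    using that by blast
  define V where "V X = \<Union>(inc ` X)" for X
  define tight where "tight T \<longleftrightarrow> T \<subseteq> I \<and> T \<noteq> {} \<and> card (V T) = Suc (card T)" for T
  define M where "M = {T. tight T \<and> (\<forall>T'. tight T' \<longrightarrow> T \<subseteq> T' \<longrightarrow> T = T')}"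
  \<comment> \<open>\<open>C\<close> collects the elements spanned by some maximal tight family.
    \<open>I\<close> and \<open>J\<close> are compared separately outside and inside
    \<open>C\<close>.\<close>
  define C where "C = {e. \<exists>T \<in> M. inc e \<subseteq> V T}"
  have finV: "finite (V X)" if "X \<subseteq> I \<union> J" for X
    unfolding V_def using that fin fin_inc by (meson finite_UN_I finite_UnI finite_subset subsetD)
  have V_Un: "V (S \<union> T) = V S \<union> V T" for S T
    unfolding V_def by blast
  have tight_Un: "tight (S \<union> T)" if S: "tight S" and T: "tight T" and ST: "V S \<inter> V T \<noteq> {}" for S T
  proof -
    have sub: "S \<subseteq> I" "T \<subseteq> I" and ne: "S \<noteq> {}" and cS: "card (V S) = Suc (card S)"
      and cT: "card (V T) = Suc (card T)"
      using S T unfolding tight_def by auto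
    have f: "finite S" "finite T" "finite (V S)" "finite (V T)"
      using sub fin finV[of S] finV[of T] by (auto intro: finite_subset)
    \<comment> \<open>This strict bound gives
      \<open>card (V S \<union> V T) \<le> Suc (card (S \<union> T))\<close> by inclusion-exclusion;
      sparsity of \<open>I\<close> gives the reverse. If \<open>S\<close> and \<open>T\<close> are
      disjoint, the bound is the assumption \<open>ST\<close>.\<close>
    have "card (S \<inter> T) < card (V S \<inter> V T)"
    proof (cases "S \<inter> T = {}")
      case True
      then show ?thesis using ST f by (simp add: card_gt_0_iff)
    next
      case False
      have "card (S \<inter> T) < card (V (S \<inter> T))"
        using sparseD[OF I, of "S \<inter> T"] False sub unfolding V_def by blast
      also have "\<dots> \<le> card (V S \<inter> V T)"
        using f by (intro card_mono) (auto simp: V_def)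
      finally show ?thesis .
    qed
    moreover have "card (S \<union> T) + card (S \<inter> T) = card S + card T"
      using card_Un_Int[OF f(1,2)] by simp
    moreover have "card (V S \<union> V T) + card (V S \<inter> V T) = card (V S) + card (V T)"
      using card_Un_Int[OF f(3,4)] by simp
    moreover have "card (S \<union> T) < card (V S \<union> V T)"
      using sparseD[OF I, of "S \<union> T"] sub ne V_Un unfolding V_def by auto
    ultimately have "card (V S \<union> V T) = Suc (card (S \<union> T))"
      using cS cT by linarith
    then show ?thesis
      using sub ne unfolding tight_def V_Un by auto
  qed
  have "finite {T. tight T}"
    by (rule finite_subset[of _ "Pow I"]) (use fin in \<open>auto simp: tight_def\<close>)
  then have ex_M: "\<exists>T' \<in> M. T \<subseteq> T'" if "tight T" for T
    using finite_has_maximal2[of "{T. tight T}" T] that unfolding M_def by auto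
  have M_disj: "S = T" if "S \<in> M" "T \<in> M" "V S \<inter> V T \<noteq> {}" for S T
    using tight_Un[of S T] that unfolding M_def by blast
  have M_sub: "T \<subseteq> I" "T \<noteq> {}" "card (V T) = Suc (card T)" if "T \<in> M" for T
    using that unfolding M_def tight_def by auto
  have "finite M"
    by (rule finite_subset[of _ "Pow I"]) (use fin M_sub in auto)
  \<comment> \<open>A violating \<open>X\<close> must contain \<open>x\<close>, and removing
    \<open>x\<close> leaves a tight \<open>T\<close> with the same union. So \<open>inc x\<close>
    lies in the union of a maximal tight family, that is, \<open>x \<in> C\<close>.\<close>
  have "J - C \<subseteq> I - C"
  proof (rule ccontr)
    assume "\<not> J - C \<subseteq> I - C"
    then obtain x where x: "x \<in> J" "x \<notin> I" "x \<notin> C" by blast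
    obtain X where X: "X \<subseteq> insert x I" "X \<noteq> {}" "card (V X) \<le> card X"
      using no_ext[of x] x unfolding sparse_def V_def by (auto simp: not_less)
    define T where "T = X - {x}"
    have T: "T \<subseteq> I" "finite T" "x \<notin> T"
      using X fin unfolding T_def by (auto intro: finite_subset)
    have "x \<in> X"
      using sparseD[OF I, of X] X unfolding V_def by auto
    hence X_eq: "X = insert x T"
      unfolding T_def by blast
    have "T \<noteq> {}"
    proof
      assume "T = {}"
      with X_eq X(3) sparseD[OF J, of "{x}"] x show False
        unfolding V_def by simp
    qed
    hence lt: "card T < card (V T)"
      using sparseD[OF I T(1)] unfolding V_def by blast
    have VX: "V X = inc x \<union> V T" "finite (V X)"
      using X_eq x T(1) finV[of X] unfolding V_def by auto
    have le: "card (V T) \<le> card (V X)"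
      using VX by (intro card_mono) auto
    have cX: "card X = Suc (card T)"
      using X_eq T by simp
    \<comment> \<open>Here \<open>card T < card (V T) \<le> card (V X) \<le> card X = Suc (card
      T)\<close>, so equality holds in the last two places.\<close>
    have "V T = V X"
      using VX le lt cX X(3) by (intro card_subset_eq) auto
    moreover have "tight T"
      unfolding tight_def using T \<open>T \<noteq> {}\<close> le lt cX X(3) by auto
    then obtain T' where "T' \<in> M" "T \<subseteq> T'"
      using ex_M by blast
    moreover have "V T \<subseteq> V T'"
      using \<open>T \<subseteq> T'\<close> unfolding V_def by blast
    ultimately show False
      using x(3) VX unfolding C_def by blast
  qed
  hence diff: "card (J - C) \<le> card (I - C)"
    using fin by (intro card_mono) auto
  \<comment> \<open>Sparsity of \<open>J\<close> admits fewer than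
    \<open>card (V T) = Suc (card T)\<close> members inside \<open>V T\<close>.\<close>
  have cover: "card {e \<in> J. inc e \<subseteq> V T} \<le> card T" if "T \<in> M" for T
  proof (cases "{e \<in> J. inc e \<subseteq> V T} = {}")
    case False
    have "card {e \<in> J. inc e \<subseteq> V T} < card (V {e \<in> J. inc e \<subseteq> V T})"
      using sparseD[OF J _ False] unfolding V_def by auto
    also have "\<dots> \<le> card (V T)"
    proof (rule card_mono)
      show "finite (V T)" using M_sub[OF that] by (intro finV) auto
      show "V {e \<in> J. inc e \<subseteq> V T} \<subseteq> V T" by (auto simp: V_def[of "{e \<in> J. inc e \<subseteq> V T}"])
    qed
    finally show ?thesis
      using M_sub[OF that] by simp
  next
    case True
    show ?thesis unfolding True by simp
  qed
  \<comment> \<open>The bounds add up to the size of the union because members of \<open>M\<close>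
    are disjoint: a common element has a nonempty point set, so their unions would meet.\<close>
  have "card (J \<inter> C) = card (\<Union>T\<in>M. {e \<in> J. inc e \<subseteq> V T})"
    by (rule arg_cong[of _ _ card]) (auto simp: C_def)
  also have "\<dots> \<le> (\<Sum>T\<in>M. card {e \<in> J. inc e \<subseteq> V T})"
    using \<open>finite M\<close> by (rule card_UN_le)
  also have "\<dots> \<le> (\<Sum>T\<in>M. card T)"
    using cover by (rule sum_mono)
  also have "\<dots> = card (\<Union>T\<in>M. T)"
  proof (rule card_UN_disjoint[symmetric])
    show "\<forall>T\<in>M. finite T"
      using M_sub fin by (meson finite_subset)
    show "\<forall>S\<in>M. \<forall>T\<in>M. S \<noteq> T \<longrightarrow> S \<inter> T = {}"
    proof (intro ballI impI, rule ccontr)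
      fix S T assume ST: "S \<in> M" "T \<in> M" "S \<noteq> T" "S \<inter> T \<noteq> {}"
      then obtain e where e: "e \<in> S" "e \<in> T" by blast
      hence "inc e \<noteq> {}"
        using sparse_nonempty[OF I] M_sub[OF ST(1)] by blast
      hence "V S \<inter> V T \<noteq> {}"
        using e unfolding V_def by blast
      with M_disj ST show False by blast
    qed
  qed fact
  also have "\<dots> \<le> card (I \<inter> C)"
  proof (rule card_mono)
    show "(\<Union>T\<in>M. T) \<subseteq> I \<inter> C"
      using M_sub unfolding C_def V_def by blast
  qed (use fin in simp)
  finally have "card (J \<inter> C) \<le> card (I \<inter> C)" .
  moreover have "card J = card (J \<inter> C) + card (J - C)" "card I = card (I \<inter> C) + card (I - C)"
    using fin by (auto simp: card_Int_Diff)
  ultimately show False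
    using diff less by linarith
qed

lemma matroid_sparse:
  assumes "finite E" and "\<And>e. e \<in> E \<Longrightarrow> finite (inc e)"
  shows "matroid E {F. F \<subseteq> E \<and> sparse inc F}"
proof
  fix I J assume IJ: "I \<in> {F. F \<subseteq> E \<and> sparse inc F}" "J \<in> {F. F \<subseteq> E \<and> sparse inc F}"
    and "card I < card J"
  moreover from IJ have "finite I" "finite J"
    using assms(1) by (auto intro: finite_subset)
  ultimately have "\<exists>x \<in> J - I. sparse inc (insert x I)"
    using assms(2) by (intro sparse_augmentation) auto
  then show "\<exists>x \<in> J - I. insert x I \<in> {F. F \<subseteq> E \<and> sparse inc F}"
    using IJ by blast
qed (use assms in \<open>auto simp: sparse_def\<close>)


section \<open>Cycle matroids\<close>

text \<open>All ends of the edges of a cycle lie among its vertices, which are as many as its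
  edges.\<close>

lemma graph_cycle_not_sparse:
  assumes "graph_cycle G vs es" "set es \<subseteq> F"
  shows "\<not> sparse (ends G) F"
proof
  assume "sparse (ends G) F"
  hence lt: "card (set es) < card (\<Union>(ends G ` set es))"
    using sparseD[OF _ assms(2)] assms(1) unfolding graph_cycle_def by auto
  have "ends G e \<subseteq> set vs" if "e \<in> set es" for e
    using that assms(1) unfolding graph_cycle_def
    by (auto simp: in_set_conv_nth) (metis length_greater_0_conv mod_less_divisor nth_mem)+
  hence "card (\<Union>(ends G ` set es)) \<le> card (set vs)"
    by (intro card_mono) auto
  also have "\<dots> = card (set es)"
    using assms(1) unfolding graph_cycle_def by (simp add: distinct_card)
  finally show False using lt by simp
qed

section \<open>Existence of cycles in edge sets that are not sparse\<close>

definition edge_path :: "('e \<Rightarrow> 'v set) \<Rightarrow> 'v list \<Rightarrow> 'e list \<Rightarrow> bool" where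
  "edge_path inc vs es \<longleftrightarrow> length vs = Suc (length es) \<and> distinct vs \<and>
     (\<forall>i < length es. inc (es ! i) = {vs ! i, vs ! Suc i})"

lemma edge_path_Cons:
  assumes "edge_path inc (v # vs) es" "inc e = {w, v}" "w \<notin> set (v # vs)"
  shows "edge_path inc (w # v # vs) (e # es)"
  using assms unfolding edge_path_def by (auto simp: less_Suc_eq_0_disj)

text \<open>A path is required to have distinct vertices only; since these make the pairs of
  consecutive vertices distinct, no edge can recur.\<close>

lemma edge_path_distinct:
  assumes "edge_path inc vs es"
  shows "distinct es"
  unfolding distinct_conv_nth
proof (intro allI impI notI)
  fix i j assume ij: "i < length es" "j < length es" "i \<noteq> j" "es ! i = es ! j"
  hence "{vs ! i, vs ! Suc i} = {vs ! j, vs ! Suc j}"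
    using assms unfolding edge_path_def by metis
  thus False
    using ij assms unfolding edge_path_def
    by (auto simp: doubleton_eq_iff nth_eq_iff_index_eq)
qed

text \<open>An edge that closes the initial vertex of a longest path up yields the cycle.\<close>
lemma min_degree_two_cycle:
  assumes G: "finite_multigraph G" and F: "F \<subseteq> edges G" "F \<noteq> {}"
    and two: "\<And>e. e \<in> F \<Longrightarrow> card (ends G e) = 2"
    and deg: "\<And>e v. e \<in> F \<Longrightarrow> v \<in> ends G e \<Longrightarrow> \<exists>e' \<in> F. e' \<noteq> e \<and> v \<in> ends G e'"
  shows "\<exists>vs es. graph_cycle G vs es \<and> set es \<subseteq> F"
proof -
  define P where "P n \<longleftrightarrow> (\<exists>vs es. edge_path (ends G) vs es \<and> set es \<subseteq> F \<and> es \<noteq> [] \<and>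
    set vs \<subseteq> vertices G \<and> length es = n)" for n
  have V: "finite (vertices G)" "\<And>e. e \<in> F \<Longrightarrow> ends G e \<subseteq> vertices G"
    using G F unfolding finite_multigraph_def by auto
  obtain e0 where e0: "e0 \<in> F" using F by blast
  obtain u w where uw: "ends G e0 = {u, w}" "u \<noteq> w"
    using two[OF e0] unfolding card_2_iff by blast
  have "P 1"
    unfolding P_def using e0 uw V(2)[OF e0]
    by (intro exI[of _ "[u, w]"] exI[of _ "[e0]"]) (auto simp: edge_path_def)
  moreover have "n \<le> card (vertices G)" if "P n" for n
  proof -
    obtain vs es where "edge_path (ends G) vs es" "set vs \<subseteq> vertices G" "length es = n"
      using \<open>P n\<close> unfolding P_def by metis
    thus ?thesis
      using card_mono[OF V(1), of "set vs"] unfolding edge_path_def by (auto simp: distinct_card)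
  qed
  \<comment> \<open>A longest path exists, since distinct vertices bound the length.\<close>
  ultimately obtain n where n: "P n" and max: "\<And>m. P m \<Longrightarrow> m \<le> n"
    using Greatest_le_nat[of P] GreatestI_nat[of P] by metis
  obtain vs es where p: "edge_path (ends G) vs es" "set es \<subseteq> F" "es \<noteq> []" "set vs \<subseteq> vertices G"
    "length es = n"
    using n unfolding P_def by blast
  obtain v vs' where vs: "vs = v # vs'"
    using p(1) unfolding edge_path_def by (cases vs) auto
  have len: "length vs = Suc (length es)" and dvs: "distinct vs"
    and en: "\<And>i. i < length es \<Longrightarrow> ends G (es ! i) = {vs ! i, vs ! Suc i}"
    using p(1) unfolding edge_path_def by auto
  have "es ! 0 \<in> F" "v \<in> ends G (es ! 0)"
    using p en[of 0] vs by auto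
  then obtain e where e: "e \<in> F" "e \<noteq> es ! 0" "v \<in> ends G e"
    using deg by blast
  obtain w where w: "ends G e = {w, v}" "w \<noteq> v"
    using two[OF e(1)] e(3) unfolding card_2_iff by (metis insert_commute insert_iff singletonD)
  \<comment> \<open>Otherwise \<open>e\<close> would extend the longest path in front.\<close>
  have "w \<in> set vs"
  proof (rule ccontr)
    assume "w \<notin> set vs"
    hence "edge_path (ends G) (w # vs) (e # es)"
      using edge_path_Cons[of "ends G" v vs' es e w] p(1) vs w by simp
    hence "P (Suc n)"
      unfolding P_def using p e(1) w V(2)[OF e(1)]
      by (intro exI[of _ "w # vs"] exI[of _ "e # es"]) auto
    thus False using max by fastforce
  qed
  then obtain k where k: "k < length vs" "vs ! k = w"
    by (auto simp: in_set_conv_nth)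
  have k0: "0 < k" using k w vs by (cases k) auto
  have k_le: "k \<le> length es" using k len by simp
  \<comment> \<open>Among the edges of the path only the one at index 0 meets \<open>v\<close>, and
    \<open>e\<close> was chosen different from it.\<close>
  have e_notin: "e \<notin> set (take k es)"
  proof
    assume "e \<in> set (take k es)"
    then obtain i where i: "i < length es" "es ! i = e"
      by (meson in_set_conv_nth in_set_takeD)
    with e(2) have "i \<noteq> 0" by metis
    moreover have "vs ! 0 \<in> {vs ! i, vs ! Suc i}"
      using en[OF i(1)] i e(3) vs by auto
    ultimately show False
      using i len dvs by (auto simp: nth_eq_iff_index_eq)
  qed
  \<comment> \<open>The cycle follows the path from \<open>v\<close> to \<open>w\<close> and returns
    by \<open>e\<close>. The closing edge has index \<open>k\<close>, where the modulus
    \<open>Suc k\<close> leads back to vertex 0.\<close>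
  have "graph_cycle G (take (Suc k) vs) (take k es @ [e])"
    unfolding graph_cycle_def
  proof (intro conjI allI impI)
    show "distinct (take k es @ [e])"
      using e_notin edge_path_distinct[OF p(1)] by simp
    show "set (take (Suc k) vs) \<subseteq> vertices G"
      using p(4) set_take_subset by fastforce
    show "set (take k es @ [e]) \<subseteq> edges G"
      using p(2) e(1) F(1) set_take_subset by fastforce
    fix i assume i: "i < length (take k es @ [e])"
    show "ends G ((take k es @ [e]) ! i) =
        {take (Suc k) vs ! i, take (Suc k) vs ! (Suc i mod length (take k es @ [e]))}"
    proof (cases "i = k")
      case True
      moreover have "vs ! 0 = v" using vs by simp
      ultimately show ?thesis using k k_le w by (simp add: nth_append)
    next
      case False
      then show ?thesis using i k_le en[of i] by (simp add: nth_append)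
    qed
  qed (use dvs k k_le in auto)
  moreover have "set (take k es @ [e]) \<subseteq> F"
    using p(2) e(1) set_take_subset by fastforce
  ultimately show ?thesis by blast
qed

text \<open>A smallest violating set either contains a loop or satisfies the degree condition of
  \<open>min_degree_two_cycle\<close>: deleting an edge with a private end loses one edge and at
  least one vertex, leaving a smaller violation.\<close>

lemma not_sparse_graph_cycle:
  assumes G: "finite_multigraph G" and F: "F \<subseteq> edges G" and "\<not> sparse (ends G) F"
  shows "\<exists>vs es. graph_cycle G vs es \<and> set es \<subseteq> F"
proof -
  define V where "V X = \<Union>(ends G ` X)" for X
  define Q where "Q X \<longleftrightarrow> X \<subseteq> F \<and> X \<noteq> {} \<and> card (V X) \<le> card X" for X
  have "\<exists>X. Q X"
    using assms(3) unfolding Q_def sparse_def V_def by (auto simp: not_less)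
  then obtain X where X: "Q X" and min: "\<And>Y. Q Y \<Longrightarrow> card X \<le> card Y"
    using ex_has_least_nat[of Q _ card] by blast
  have XF: "X \<subseteq> F" "X \<noteq> {}" "card (V X) \<le> card X"
    using X unfolding Q_def by auto
  have finX: "finite X"
    using G F XF unfolding finite_multigraph_def by (meson finite_subset)
  have "finite (vertices G)" and ends: "ends G e \<subseteq> vertices G" "card (ends G e) \<in> {1, 2}"
    if "e \<in> X" for e
    using G F XF that unfolding finite_multigraph_def by blast+
  hence fin_ends: "finite (ends G e)" if "e \<in> X" for e
    using that finite_subset by blast
  have finV: "finite (V X)"
    unfolding V_def using finX fin_ends by blast
  show ?thesis
  proof (cases "\<exists>e \<in> X. card (ends G e) = 1")
    case True
    then obtain e v where e: "e \<in> X" "ends G e = {v}"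
      by (auto simp: card_1_singleton_iff)
    then have "graph_cycle G [v] [e]"
      using ends(1)[OF e(1)] F XF unfolding graph_cycle_def by auto
    with e XF show ?thesis by (intro exI[of _ "[v]"] exI[of _ "[e]"]) auto
  next
    case False
    hence two: "card (ends G e) = 2" if "e \<in> X" for e
      using that ends(2) by blast
    have "\<exists>e' \<in> X. e' \<noteq> e \<and> v \<in> ends G e'" if e: "e \<in> X" "v \<in> ends G e" for e v
    proof (rule ccontr)
      assume "\<not> ?thesis"
      hence "V (X - {e}) \<subseteq> V X - {v}"
        unfolding V_def by blast
      hence "card (V (X - {e})) \<le> card (V X - {v})"
        using finV by (intro card_mono) auto
      also have "\<dots> = card (V X) - 1"
        using e finV by (intro card_Diff_singleton) (auto simp: V_def)
      also have "\<dots> \<le> card (X - {e})"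
        using XF e finX by simp
      finally have le: "card (V (X - {e})) \<le> card (X - {e})" .
      \<comment> \<open>A single edge with two ends is no violation.\<close>
      have "X - {e} \<noteq> {}"
      proof
        assume "X - {e} = {}"
        hence "X = {e}" using e by blast
        thus False using XF(3) two[OF e(1)] unfolding V_def by simp
      qed
      with le XF have "Q (X - {e})" unfolding Q_def by blast
      from min[OF this] show False
        using e finX by (metis card_Diff1_less linorder_not_less)
    qed
    then have "\<exists>vs es. graph_cycle G vs es \<and> set es \<subseteq> X"
      using F XF two by (intro min_degree_two_cycle[OF G]) auto
    with XF show ?thesis by blast
  qed
qed

section \<open>Cycle matroids as matroids of sparse edge sets\<close>

lemma acyclic_edge_sets_eq_sparse:
  assumes "finite_multigraph G"
  shows "acyclic_edge_sets G = {F. F \<subseteq> edges G \<and> sparse (ends G) F}"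
  unfolding acyclic_edge_sets_def
  using graph_cycle_not_sparse not_sparse_graph_cycle[OF assms] by blast

lemma graphic_matroid_acyclic_edge_sets:
  fixes G :: "('v, 'e) multigraph"
  assumes G: "finite_multigraph G"
  shows "graphic_matroid (edges G) (acyclic_edge_sets G)"
  unfolding graphic_matroid_def
proof
  have fin: "finite (vertices G)" "finite (edges G)"
    and en: "\<And>e. e \<in> edges G \<Longrightarrow> ends G e \<subseteq> vertices G"
      "\<And>e. e \<in> edges G \<Longrightarrow> card (ends G e) \<in> {1, 2}"
    using G unfolding finite_multigraph_def by auto
  show "matroid (edges G) (acyclic_edge_sets G)"
    unfolding acyclic_edge_sets_eq_sparse[OF G]
    using fin en by (intro matroid_sparse) (auto intro: finite_subset)
  obtain g :: "'v \<Rightarrow> nat" where g: "inj_on g (vertices G)"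
    using finite_imp_inj_to_nat_seg[OF fin(1)] by blast
  obtain f :: "'e \<Rightarrow> nat" where f: "inj_on f (edges G)"
    using finite_imp_inj_to_nat_seg[OF fin(2)] by blast
  \<comment> \<open>A copy of \<open>G\<close> on natural numbers, as \<open>graphic_matroid\<close>
    demands; \<open>inv_into\<close> recovers the edge from its number.\<close>
  define H :: "(nat, nat) multigraph" where
    "H = \<lparr>vertices = g ` vertices G, edges = f ` edges G,
      ends = (\<lambda>n. g ` ends G (inv_into (edges G) f n))\<rparr>"
  have ends_H: "ends H (f e) = g ` ends G e" if "e \<in> edges G" for e
    using that f by (simp add: H_def)
  have H: "finite_multigraph H"
    unfolding finite_multigraph_def
  proof (intro conjI ballI)
    fix n assume "n \<in> edges H"
    then obtain e where e: "e \<in> edges G" "n = f e" by (auto simp: H_def)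
    show "ends H n \<subseteq> vertices H"
      using e ends_H[OF e(1)] image_mono[OF en(1)[OF e(1)], of g] by (simp add: H_def)
    have "card (ends H n) = card (ends G e)"
      using e ends_H en(1) g by (metis card_image inj_on_subset)
    thus "card (ends H n) \<in> {1, 2}"
      using en(2) e by metis
  qed (use fin in \<open>auto simp: H_def\<close>)
  have "X \<in> acyclic_edge_sets G \<longleftrightarrow> f ` X \<in> acyclic_edge_sets H" if "X \<subseteq> edges G" for X
    using sparse_image_iff[where inc = "ends G" and inc' = "ends H", OF f g en(1) ends_H that] that
    unfolding acyclic_edge_sets_eq_sparse[OF G] acyclic_edge_sets_eq_sparse[OF H]
    by (auto simp: H_def)
  moreover have "bij_betw f (edges G) (edges H)"
    using f by (simp add: H_def bij_betw_def)
  ultimately show "\<exists>H :: (nat, nat) multigraph. finite_multigraph H \<and>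
      matroid_isomorphic (edges G) (acyclic_edge_sets G) (edges H) (acyclic_edge_sets H)"
    using H unfolding matroid_isomorphic_def by blast
qed


section \<open>The split graph of a digraph\<close>

text \<open>\<open>Inl\<close> marks tail copies and \<open>Inr\<close> head copies. The arcs
  themselves serve as edges, so the isomorphism of matroids becomes an equality of families.\<close>

definition split_graph :: "('a, 'b) pre_digraph \<Rightarrow> ('a + 'a, 'b) multigraph" where
  "split_graph D = \<lparr>vertices = Inl ` verts D \<union> Inr ` verts D, edges = arcs D,
     ends = (\<lambda>e. {Inl (tail D e), Inr (head D e)})\<rparr>"

lemma split_graph_simps [simp]:
  "vertices (split_graph D) = Inl ` verts D \<union> Inr ` verts D"
  "edges (split_graph D) = arcs D"
  "ends (split_graph D) e = {Inl (tail D e), Inr (head D e)}"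
  by (simp_all add: split_graph_def)

lemma finite_multigraph_split_graph:
  assumes "fin_digraph D"
  shows "finite_multigraph (split_graph D)"
proof -
  interpret fin_digraph D by fact
  show ?thesis
    unfolding finite_multigraph_def by auto
qed

text \<open>The two sides of the split graph are disjoint, so the number of covered vertices is
  heads plus tails; the term \<open>- 1\<close> turns into strictness.\<close>

lemma independent_arcs_iff_sparse:
  assumes "fin_digraph D"
  shows "independent_arcs D I \<longleftrightarrow> I \<subseteq> arcs D \<and> sparse (ends (split_graph D)) I"
proof -
  interpret fin_digraph D by fact
  have "card (\<Union>(ends (split_graph D) ` X)) = num_heads D X + num_tails D X"
    if "X \<subseteq> arcs D" for X
  proof -
    have "finite X" using that finite_arcs by (rule finite_subset)
    have "\<Union>(ends (split_graph D) ` X) = Inr ` head D ` X \<union> Inl ` tail D ` X" by auto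
    also have "card \<dots> = card (Inr ` head D ` X :: ('a + 'a) set) + card (Inl ` tail D ` X :: ('a + 'a) set)"
      using \<open>finite X\<close> by (intro card_Un_disjoint) auto
    finally show ?thesis
      by (simp add: num_heads_def num_tails_def card_image)
  qed
  hence "int (card X) \<le> int (num_heads D X) + int (num_tails D X) - 1 \<longleftrightarrow>
      card X < card (\<Union>(ends (split_graph D) ` X))" if "X \<subseteq> arcs D" for X
    using that by auto
  then show ?thesis
    unfolding independent_arcs_def sparse_def by (meson subset_trans)
qed

section \<open>Closed antidirected trails and cycles of the split graph\<close>

lemma twice_card_image_le:
  assumes "finite A" and "\<And>a. a \<in> A \<Longrightarrow> \<exists>b \<in> A. b \<noteq> a \<and> f b = f a"
  shows "2 * card (f ` A) \<le> card A"
proof -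
  \<comment> \<open>Every fibre of \<open>f\<close> over its image has at least two elements, and
    the fibres partition \<open>A\<close>.\<close>
  have "2 \<le> card {a \<in> A. f a = y}" if "y \<in> f ` A" for y
  proof -
    obtain a b where "a \<in> A" "b \<in> A" "b \<noteq> a" "f a = y" "f b = y"
      using \<open>y \<in> f ` A\<close> assms(2) by (metis imageE)
    hence "card {a, b} \<le> card {a \<in> A. f a = y}"
      using assms(1) by (intro card_mono) auto
    thus ?thesis using \<open>b \<noteq> a\<close> by simp
  qed
  hence "(\<Sum>y\<in>f ` A. 2) \<le> (\<Sum>y\<in>f ` A. card {a \<in> A. f a = y})"
    by (rule sum_mono)
  also have "\<dots> = card A"
    using sum.image_gen[OF assms(1), of "\<lambda>_. 1 :: nat" f] by simp
  finally show ?thesis by simp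
qed

text \<open>Consecutive arcs of the trail share a head or a tail, so every head and every tail is
  attained at least twice.\<close>
lemma closed_antidirected_trail_not_independent:
  assumes "fin_digraph D" "loopfree_digraph D"
    and trail: "closed_antidirected_trail D vs es" and sub: "set es \<subseteq> F"
  shows "\<not> independent_arcs D F"
proof
  interpret loopfree_digraph D by fact
  assume indep: "independent_arcs D F"
  define n where "n = length es"
  define fw where "fw = forward_step D vs es"
  have walk: "length vs = Suc n" "set es \<subseteq> arcs D" "hd vs = last vs" "even n" "0 < n" "distinct es"
    and dir: "\<And>i. i < n \<Longrightarrow> fw i \<or> backward_step D vs es i"
    and alt: "\<And>i. Suc i < n \<Longrightarrow> fw i \<and> backward_step D vs es (Suc i) \<or>
        backward_step D vs es i \<and> fw (Suc i)"
    using trail unfolding closed_antidirected_trail_def underlying_walk_def n_def fw_def by auto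
  have excl: "\<not> (fw i \<and> backward_step D vs es i)" if "i < n" for i
  proof -
    have "es ! i \<in> arcs D" using that walk(2) n_def by auto
    then show ?thesis
      using no_loops[of "es ! i"] unfolding fw_def forward_step_def backward_step_def by auto
  qed
  have bw: "backward_step D vs es i \<longleftrightarrow> \<not> fw i" if "i < n" for i
    using that dir excl by blast
  have parity: "fw i \<longleftrightarrow> (fw 0 \<longleftrightarrow> even i)" if "i < n" for i
    using that
  proof (induction i)
    case (Suc i)
    then show ?case using alt[of i] bw[of i] bw[of "Suc i"] by auto
  qed simp
  have closed: "vs ! n = vs ! 0"
    using walk(1,3) hd_conv_nth[of vs] last_conv_nth[of vs] by fastforce
  \<comment> \<open>The definition prescribes no alternation between the last and the first arc;
    there it follows from the even length. So both cyclic neighbours of an arc run in the opposite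
    direction.\<close>
  have succ: "\<exists>j < n. j \<noteq> i \<and> fw j = (\<not> fw i) \<and> vs ! Suc i = vs ! j" if "i < n" for i
  proof (cases "Suc i = n")
    case True
    then have "i \<noteq> 0" using walk(4) by (metis odd_one One_nat_def)
    with True show ?thesis
      using walk closed parity[of i] by (intro exI[of _ 0]) auto
  next
    case False
    then show ?thesis
      using that parity[of i] parity[of "Suc i"] by (intro exI[of _ "Suc i"]) auto
  qed
  have pred: "\<exists>j < n. j \<noteq> i \<and> fw j = (\<not> fw i) \<and> vs ! Suc j = vs ! i" if "i < n" for i
  proof (cases i)
    case 0
    have "n \<noteq> 1" using walk(4) by (metis odd_one)
    with 0 show ?thesis
      using walk closed parity[of "n - 1"] by (intro exI[of _ "n - 1"]) auto
  next
    case (Suc k)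
    then show ?thesis
      using that parity[of k] parity[of "Suc k"] by (intro exI[of _ k]) auto
  qed
  \<comment> \<open>A forward arc shares its head with its successor and its tail with its
    predecessor; for a backward arc the roles are exchanged.\<close>
  have heads: "\<exists>j < n. j \<noteq> i \<and> head D (es ! j) = head D (es ! i)"
    and tails: "\<exists>j < n. j \<noteq> i \<and> tail D (es ! j) = tail D (es ! i)" if "i < n" for i
    using succ[OF that] pred[OF that] bw that
    unfolding fw_def forward_step_def backward_step_def by metis+
  have arcs_other: "\<exists>e' \<in> set es. e' \<noteq> e \<and> f e' = f e"
    if "e \<in> set es" and f: "\<And>i. i < n \<Longrightarrow> \<exists>j < n. j \<noteq> i \<and> f (es ! j) = f (es ! i)"
    for e and f :: "'b \<Rightarrow> 'a"
    using that walk(6) unfolding n_def by (metis in_set_conv_nth nth_eq_iff_index_eq)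
  have "2 * card (head D ` set es) \<le> card (set es)" "2 * card (tail D ` set es) \<le> card (set es)"
    using arcs_other heads tails by (auto intro!: twice_card_image_le)
  moreover have "set es \<noteq> {}" using walk(5) n_def by auto
  hence "int (card (set es)) \<le> int (card (head D ` set es)) + int (card (tail D ` set es)) - 1"
    using indep sub unfolding independent_arcs_def num_heads_def num_tails_def by blast
  ultimately show False by linarith
qed

text \<open>Forgetting the sides projects the cycle to a closed walk. Leaving a tail copy is a
  forward step and leaving a head copy a backward one, so the alternation of sides becomes
  alternation of directions.\<close>

lemma split_graph_cycle_imp_closed_antidirected_trail:
  assumes D: "fin_digraph D" and cyc: "graph_cycle (split_graph D) vs es"
  shows "\<exists>ws. closed_antidirected_trail D ws es"
proof -
  define n where "n = length es"
  define pr :: "'a + 'a \<Rightarrow> 'a" where "pr = case_sum id id"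
  \<comment> \<open>A trail lists its first vertex again at the end, a cycle does not.\<close>
  define ws where "ws = map pr vs @ [pr (vs ! 0)]"
  have c: "es \<noteq> []" "0 < n" "length vs = n" "distinct es" "set es \<subseteq> arcs D"
      "set vs \<subseteq> Inl ` verts D \<union> Inr ` verts D"
    and ends: "\<And>i. i < n \<Longrightarrow>
        {Inl (tail D (es ! i)), Inr (head D (es ! i))} = {vs ! i, vs ! (Suc i mod n)}"
    using cyc unfolding graph_cycle_def n_def by auto
  have ws_nth: "ws ! i = pr (vs ! (i mod n))" if "i \<le> n" for i
    using that c by (cases "i = n") (auto simp: ws_def nth_append)
  have pr_simps: "pr (Inl a) = a" "pr (Inr a) = a" for a
    by (simp_all add: pr_def)
  have step: "vs ! i = Inl (tail D (es ! i)) \<and> vs ! (Suc i mod n) = Inr (head D (es ! i)) \<or>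
      vs ! i = Inr (head D (es ! i)) \<and> vs ! (Suc i mod n) = Inl (tail D (es ! i))" if "i < n" for i
    using ends[OF that] unfolding doubleton_eq_iff by metis
  have fw: "forward_step D ws es i" if "i < n" "isl (vs ! i)" for i
    using step[OF that(1)] that ws_nth[of i] ws_nth[of "Suc i"]
    unfolding forward_step_def by (auto simp: pr_simps)
  have bw: "backward_step D ws es i" if "i < n" "\<not> isl (vs ! i)" for i
    using step[OF that(1)] that ws_nth[of i] ws_nth[of "Suc i"]
    unfolding backward_step_def by (auto simp: pr_simps)
  have switch: "isl (vs ! (Suc i mod n)) \<longleftrightarrow> \<not> isl (vs ! i)" if "i < n" for i
    using step[OF that] by auto
  have parity: "isl (vs ! i) \<longleftrightarrow> (isl (vs ! 0) \<longleftrightarrow> even i)" if "i < n" for i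
    using that
  proof (induction i)
    case (Suc i)
    then show ?case using switch[of i] by auto
  qed simp
  \<comment> \<open>The step from index \<open>n - 1\<close> back to 0 also switches sides, so
    \<open>n - 1\<close> is odd.\<close>
  have "even n"
    using parity[of "n - 1"] switch[of "n - 1"] c(2) by auto
  moreover have "set ws \<subseteq> verts D"
    using c nth_mem[of 0 vs] unfolding ws_def by (auto simp: pr_simps subset_iff)
  moreover have "hd ws = last ws"
    using c unfolding ws_def by (cases vs) auto
  moreover have "length ws = Suc n"
    using c by (simp add: ws_def)
  moreover have "forward_step D ws es i \<and> backward_step D ws es (Suc i) \<or>
      backward_step D ws es i \<and> forward_step D ws es (Suc i)" if "Suc i < n" for i
    using that fw[of i] fw[of "Suc i"] bw[of i] bw[of "Suc i"] switch[of i] by auto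
  moreover have "forward_step D ws es i \<or> backward_step D ws es i" if "i < n" for i
    using that fw bw by blast
  ultimately show ?thesis
    using c unfolding closed_antidirected_trail_def underlying_walk_def n_def by blast
qed

section \<open>Identification of the set families\<close>

lemma independent_arcs_eq_acyclic_edge_sets:
  assumes "fin_digraph D"
  shows "{I. independent_arcs D I} = acyclic_edge_sets (split_graph D)"
  using independent_arcs_iff_sparse[OF assms]
    acyclic_edge_sets_eq_sparse[OF finite_multigraph_split_graph[OF assms]]
  by simp

text \<open>With equal families, the rank formula compares two maxima over the same sets.\<close>

lemma independent_arcs_eq_no_closed_antidirected_trail:
  assumes D: "fin_digraph D" and loopfree: "loopfree_digraph D"
  shows "{I. independent_arcs D I} =
    {F. F \<subseteq> arcs D \<and> \<not> contains_closed_antidirected_trail D F}"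
proof (intro equalityI subsetI; clarify)
  fix F assume F: "independent_arcs D F"
  then show "F \<subseteq> arcs D \<and> \<not> contains_closed_antidirected_trail D F"
    using closed_antidirected_trail_not_independent[OF D loopfree]
    unfolding contains_closed_antidirected_trail_def independent_arcs_def by blast
next
  fix F assume "F \<subseteq> arcs D" "\<not> contains_closed_antidirected_trail D F"
  then have "F \<in> acyclic_edge_sets (split_graph D)"
    using split_graph_cycle_imp_closed_antidirected_trail[OF D]
    unfolding acyclic_edge_sets_def contains_closed_antidirected_trail_def
    by (simp del: not_ex) blast
  then show "independent_arcs D F"
    using independent_arcs_eq_acyclic_edge_sets[OF D] by blast
qed

theorem theorem5p2:
  fixes D :: "('a, 'b) pre_digraph"
  assumes "fin_digraph D" and "loopfree_digraph D"
  shows "graphic_matroid (arcs D) {I. independent_arcs D I} \<and>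
    matroid_rank {I. independent_arcs D I} =
      Max (card ` {F. F \<subseteq> arcs D \<and> \<not> contains_closed_antidirected_trail D F})"
proof
  show "graphic_matroid (arcs D) {I. independent_arcs D I}"
    using graphic_matroid_acyclic_edge_sets[OF finite_multigraph_split_graph[OF assms(1)]]
    by (simp add: independent_arcs_eq_acyclic_edge_sets[OF assms(1)])
  show "matroid_rank {I. independent_arcs D I} =
      Max (card ` {F. F \<subseteq> arcs D \<and> \<not> contains_closed_antidirected_trail D F})"
    unfolding matroid_rank_def independent_arcs_eq_no_closed_antidirected_trail[OF assms] ..
qed

end
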